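(* Let $f\in\mathcal W_\infty$ and let $A=\{a_n:n\in\mathbb N\}$ be a sequence in an abelian topological group. Then $A$ is $f$-summable if and only if it is unconditionally $f$-summable, and $A$ is $f$-Cauchy summable if and only if it is unconditionally $f$-Cauchy summable.
   Context: All topological groups are Hausdorff; $\mathbb N=\{0,1,2,\dots\}$; $\omega$ is the first infinite ordinal, $\omega+1=\mathbb N\cup\{\omega\}$, $n<\omega$ for $n\in\mathbb N$. $\mathcal W_\infty$ is the set of all functions $f:\mathbb N\to(\omega+1)\setminus\{0\}$. A sequence $\{x_n\}$ in an abelian topological group (written additively) is Cauchy if for every neighbourhood $U$ of $0$ there is $k$ with $x_m-x_l\in U$ for all $l,m\ge k$. A sequence $\{b_n:n\in\mathbb N\}$ in an abelian topological group $G$ is summable (Cauchy summable) if $\{\sum_{n=0}^m b_n:m\in\mathbb N\}$ converges to some element of $G$ (respectively, is Cauchy). A sequence $\{a_n:n\in\mathbb N\}$ in $G$ is $f$-summable ($f$-Cauchy summable) if it is faithfully indexed ($a_n\ne a_m$ for $n\ne m$) and $\{z(n)a_n:n\in\mathbb N\}$ is summable (respectively, Cauchy summable) for every $z:\mathbb N\to\mathbb Z$ with $|z(n)|\le f(n)$ for all $n$. It is unconditionally $f$-summable (unconditionally $f$-Cauchy summable) if it is faithfully indexed and $\{a_{\varphi(n)}:n\in\mathbb N\}$ is $(f\circ\varphi)$-summable (respectively, $(f\circ\varphi)$-Cauchy summable) for every bijection $\varphi:\mathbb N\to\mathbb N$. *)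

theory Defs
  imports Complex_Main "HOL-Library.Extended_Nat"
begin

text \<open>
  Hausdorff abelian topological groups are types of class
  \<^class>\<open>topological_ab_group_add\<close> and \<^class>\<open>t2_space\<close>; the ordinal \<open>\<omega> + 1\<close> is the type
  \<^typ>\<open>enat\<close>, with \<open>\<omega>\<close> rendered as \<open>\<infinity>\<close>.
\<close>

definition W_infty :: "(nat \<Rightarrow> enat) set" where
  "W_infty = {f. \<forall>n. f n \<noteq> 0}"

definition int_mult :: "int \<Rightarrow> 'a::ab_group_add \<Rightarrow> 'a" where
  "int_mult k x = (if 0 \<le> k then (\<Sum>i<nat k. x) else - (\<Sum>i<nat (- k). x))"

text \<open>
  The library's \<open>Cauchy\<close> presupposes a uniformity on the type, so the Cauchy property is
  stated here in terms of the group topology alone.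
\<close>

definition group_Cauchy :: "(nat \<Rightarrow> 'a::topological_ab_group_add) \<Rightarrow> bool" where
  "group_Cauchy x \<longleftrightarrow>
     (\<forall>U. (\<forall>\<^sub>F u in nhds 0. u \<in> U) \<longrightarrow> (\<exists>k. \<forall>l\<ge>k. \<forall>m\<ge>k. x m - x l \<in> U))"

definition Cauchy_summable :: "(nat \<Rightarrow> 'a::topological_ab_group_add) \<Rightarrow> bool" where
  "Cauchy_summable b \<longleftrightarrow> group_Cauchy (\<lambda>m. \<Sum>n\<le>m. b n)"

text \<open>
  Convergence of series is the library's \<^const>\<open>summable\<close>, whose partial sums are indexed
  as \<open>\<Sum>n<m. b n\<close>; see \<open>summable_iff_convergent'\<close> for the form \<open>\<Sum>n\<le>m. b n\<close>.
\<close>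

definition f_summable ::
  "(nat \<Rightarrow> enat) \<Rightarrow> (nat \<Rightarrow> 'a::{topological_ab_group_add, t2_space}) \<Rightarrow> bool" where
  "f_summable f a \<longleftrightarrow> inj a \<and>
     (\<forall>z :: nat \<Rightarrow> int. (\<forall>n. enat (nat \<bar>z n\<bar>) \<le> f n) \<longrightarrow> summable (\<lambda>n. int_mult (z n) (a n)))"

definition f_Cauchy_summable ::
  "(nat \<Rightarrow> enat) \<Rightarrow> (nat \<Rightarrow> 'a::{topological_ab_group_add, t2_space}) \<Rightarrow> bool" where
  "f_Cauchy_summable f a \<longleftrightarrow> inj a \<and>
     (\<forall>z :: nat \<Rightarrow> int. (\<forall>n. enat (nat \<bar>z n\<bar>) \<le> f n) \<longrightarrow>
        Cauchy_summable (\<lambda>n. int_mult (z n) (a n)))"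

definition unconditionally_f_summable ::
  "(nat \<Rightarrow> enat) \<Rightarrow> (nat \<Rightarrow> 'a::{topological_ab_group_add, t2_space}) \<Rightarrow> bool" where
  "unconditionally_f_summable f a \<longleftrightarrow> inj a \<and>
     (\<forall>\<phi> :: nat \<Rightarrow> nat. bij \<phi> \<longrightarrow> f_summable (f \<circ> \<phi>) (a \<circ> \<phi>))"

definition unconditionally_f_Cauchy_summable ::
  "(nat \<Rightarrow> enat) \<Rightarrow> (nat \<Rightarrow> 'a::{topological_ab_group_add, t2_space}) \<Rightarrow> bool" where
  "unconditionally_f_Cauchy_summable f a \<longleftrightarrow> inj a \<and>
     (\<forall>\<phi> :: nat \<Rightarrow> nat. bij \<phi> \<longrightarrow> f_Cauchy_summable (f \<circ> \<phi>) (a \<circ> \<phi>))"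

end

theory Submission
  imports Defs
begin

text \<open>
  If every subseries of \<open>\<Sum>b\<^sub>n\<close> is Cauchy, then the sums of \<open>b\<close> over finite sets \<open>F \<subseteq> {k..}\<close>
  become uniformly small as \<open>k\<close> grows: otherwise infinitely many successive finite blocks have
  sums outside a fixed neighbourhood of \<open>0\<close>, and the subseries supported on their union is not
  Cauchy. This smallness does not depend on the order of summation. Since \<open>f\<close>-boundedness of
  \<open>z\<close> is inherited when values of \<open>z\<close> are replaced by \<open>0\<close>, it applies to each \<open>z(n) a\<^sub>n\<close>.
\<close>

definition unordered_Cauchy :: "(nat \<Rightarrow> 'a::topological_ab_group_add) \<Rightarrow> bool" where
  "unordered_Cauchy b \<longleftrightarrow>
     (\<forall>U. (\<forall>\<^sub>F u in nhds 0. u \<in> U) \<longrightarrow>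
       (\<exists>k. \<forall>F. finite F \<longrightarrow> F \<subseteq> {k..} \<longrightarrow> sum b F \<in> U))"

section \<open>Neighbourhoods of zero and Cauchy sequences\<close>

text \<open>Continuity of subtraction at \<open>(0, 0)\<close>; this takes the place of halving an
  epsilon in the estimates below.\<close>

lemma nhds_zero_diff:
  fixes U :: "'a::topological_ab_group_add set"
  assumes "\<forall>\<^sub>F u in nhds 0. u \<in> U"
  obtains V where "\<forall>\<^sub>F v in nhds 0. v \<in> V" "\<And>v w. v \<in> V \<Longrightarrow> w \<in> V \<Longrightarrow> v - w \<in> U"
proof -
  have "((\<lambda>p. fst p - snd p) \<longlongrightarrow> 0 - (0::'a)) (nhds 0 \<times>\<^sub>F nhds 0)"
    by (intro tendsto_diff)
      (simp_all add: filterlim_def filtermap_fst_prod_filter filtermap_snd_prod_filter)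
  then have "\<forall>\<^sub>F p in nhds 0 \<times>\<^sub>F nhds 0. fst p - snd p \<in> U"
    using assms unfolding filterlim_iff diff_self by blast
  \<comment> \<open>Both factors of the product filter are \<open>nhds 0\<close>, so a single
    \<open>P\<close> serves both coordinates.\<close>
  then obtain P where P: "eventually P (nhds 0)"
    "\<And>v w. P v \<Longrightarrow> P w \<Longrightarrow> v - w \<in> U"
    unfolding eventually_prod_same by auto
  show thesis
    by (rule that[of "{v. P v}"]) (use P in auto)
qed

lemma sum_atMost_diff:
  fixes b :: "nat \<Rightarrow> 'a::ab_group_add"
  assumes "l \<le> m"
  shows "sum b {..m} - sum b {..l} = sum b {l<..m}"
proof -
  have "{..m} - {..l} = {l<..m}" by auto
  then show ?thesis
    using sum_diff[of "{..m}" "{..l}" b] assms by simp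
qed

lemma convergent_imp_group_Cauchy:
  fixes x :: "nat \<Rightarrow> 'a::topological_ab_group_add"
  assumes "convergent x"
  shows "group_Cauchy x"
  unfolding group_Cauchy_def
proof (intro allI impI)
  fix U :: "'a set"
  assume "\<forall>\<^sub>F u in nhds 0. u \<in> U"
  then obtain V where V: "\<forall>\<^sub>F v in nhds 0. v \<in> V"
    "\<And>v w. v \<in> V \<Longrightarrow> w \<in> V \<Longrightarrow> v - w \<in> U"
    by (rule nhds_zero_diff) blast
  obtain L where "x \<longlonglongrightarrow> L"
    using assms by (auto simp: convergent_def)
  then have "(\<lambda>n. x n - L) \<longlonglongrightarrow> 0"
    using tendsto_diff[OF _ tendsto_const, of x L sequentially L] by simp
  then have "\<forall>\<^sub>F n in sequentially. x n - L \<in> V"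
    using V(1) unfolding filterlim_iff by blast
  then obtain k where "\<And>n. n \<ge> k \<Longrightarrow> x n - L \<in> V"
    by (auto simp: eventually_sequentially)
  \<comment> \<open>The limit cancels: \<open>x m - x l = (x m - L) - (x l - L)\<close>.\<close>
  then have "x m - x l \<in> U" if "l \<ge> k" "m \<ge> k" for l m
    using V(2)[of "x m - L" "x l - L"] that by simp
  then show "\<exists>k. \<forall>l\<ge>k. \<forall>m\<ge>k. x m - x l \<in> U" by blast
qed

lemma summable_imp_Cauchy_summable:
  fixes b :: "nat \<Rightarrow> 'a::topological_ab_group_add"
  shows "summable b \<Longrightarrow> Cauchy_summable b"
  unfolding Cauchy_summable_def
  by (simp add: convergent_imp_group_Cauchy summable_iff_convergent')

section \<open>From Cauchy subseries to uniformly small finite sums\<close>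

lemma subseries_Cauchy_imp_unordered_Cauchy:
  fixes b :: "nat \<Rightarrow> 'a::topological_ab_group_add"
  assumes sub: "\<And>A. Cauchy_summable (\<lambda>n. if n \<in> A then b n else 0)"
  shows "unordered_Cauchy b"
proof (rule ccontr)
  assume "\<not> unordered_Cauchy b"
  then obtain U where U: "\<forall>\<^sub>F u in nhds 0. u \<in> U"
    and "\<forall>k. \<exists>F. finite F \<and> F \<subseteq> {k..} \<and> sum b F \<notin> U"
    by (auto simp: unordered_Cauchy_def)
  then obtain G where G: "\<And>k. finite (G k)" "\<And>k. G k \<subseteq> {k..}" "\<And>k. sum b (G k) \<notin> U"
    by metis
  have "\<exists>h>k. G k \<subseteq> {k..<h}" for k
  proof -
    obtain h where "G k \<subseteq> {..<h}"
      using G(1)[of k] finite_nat_iff_bounded by blast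
    \<comment> \<open>The maximum with \<open>Suc k\<close> secures a bound beyond \<open>k\<close>
      without looking inside \<open>G k\<close>.\<close>
    then have "G k \<subseteq> {k..<max h (Suc k)}"
      using G(2)[of k] by fastforce
    then show ?thesis
      by (intro exI[of _ "max h (Suc k)"]) simp
  qed
  then obtain h where h: "\<And>k. k < h k" "\<And>k. G k \<subseteq> {k..<h k}"
    by metis
  \<comment> \<open>Iterating \<open>h\<close> starts each block where the previous one ends, so the
    intervals \<open>{K i..<K (Suc i)}\<close> are disjoint and each contains one bad set
    \<open>G (K i)\<close>.\<close>
  define K where "K i = (h ^^ i) 0" for i
  have less: "K i < K (Suc i)" and block: "G (K i) \<subseteq> {K i..<K (Suc i)}" for i
    using h[of "K i"] by (simp_all add: K_def)
  have mono: "strict_mono K"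
    by (simp add: strict_mono_Suc_iff less)
  define A where "A = (\<Union>i. G (K i))"
  have A: "A \<inter> {K i..<K (Suc i)} = G (K i)" for i
  proof
    show "A \<inter> {K i..<K (Suc i)} \<subseteq> G (K i)"
    proof
      fix n
      assume n: "n \<in> A \<inter> {K i..<K (Suc i)}"
      then obtain j where j: "n \<in> G (K j)" by (auto simp: A_def)
      \<comment> \<open>Here \<open>n\<close> lies in the intervals of both \<open>i\<close> and
        \<open>j\<close>; strict monotonicity turns the two inequalities into
        \<open>j \<le> i\<close> and \<open>i \<le> j\<close>.\<close>
      then have "K j < K (Suc i)" "K i < K (Suc j)"
        using block[of j] n by fastforce+
      then have "i = j"
        unfolding strict_mono_less[OF mono] by simp
      then show "n \<in> G (K i)" using j by simp
    qed
  qed (use block in \<open>auto simp: A_def\<close>)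
  define c where "c n = (if n \<in> A then b n else 0)" for n
  obtain N where N: "\<And>l m. l \<ge> N \<Longrightarrow> m \<ge> N \<Longrightarrow> sum c {..m} - sum c {..l} \<in> U"
    using sub[of A, folded c_def] U unfolding Cauchy_summable_def group_Cauchy_def by meson
  \<comment> \<open>With this index \<open>K i - 1\<close> is still at least \<open>N\<close>, and
    the subtraction is not truncated at \<open>0\<close>.\<close>
  define i where "i = Suc N"
  have i: "Suc N \<le> K i"
    using strict_mono_imp_increasing[OF mono, of i] by (simp add: i_def)
  have "sum c {..K (Suc i) - 1} - sum c {..K i - 1} = sum c {K i - 1<..K (Suc i) - 1}"
    using less[of i] by (intro sum_atMost_diff) simp
  also have "{K i - 1<..K (Suc i) - 1} = {K i..<K (Suc i)}"
    using less[of i] i by auto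
  also have "sum c \<dots> = sum b ({K i..<K (Suc i)} \<inter> A)"
    by (simp add: c_def sum.inter_restrict)
  also have "{K i..<K (Suc i)} \<inter> A = G (K i)"
    using A by blast
  finally have "sum b (G (K i)) \<in> U"
    using N[of "K i - 1" "K (Suc i) - 1"] less[of i] i by simp
  then show False using G(3) by blast
qed

section \<open>Rearrangement of series\<close>

lemma bij_eventually_ge:
  fixes \<phi> :: "nat \<Rightarrow> nat"
  assumes "bij \<phi>"
  obtains K where "k \<le> K" "\<And>n. n \<ge> K \<Longrightarrow> \<phi> n \<ge> k" "\<And>m. m \<ge> K \<Longrightarrow> {..<k} \<subseteq> \<phi> ` {..<m}"
proof -
  \<comment> \<open>Only finitely many positions are sent below \<open>k\<close>; beyond all of
    them, every value is at least \<open>k\<close> and every index below \<open>k\<close> has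
    already occurred.\<close>
  have "finite (inv \<phi> ` {..<k})" by simp
  then obtain K0 where K0: "inv \<phi> ` {..<k} \<subseteq> {..<K0}"
    using finite_nat_iff_bounded by blast
  have *: "inv \<phi> j < K0" if "j < k" for j
    using K0 that by auto
  have inv: "\<phi> (inv \<phi> j) = j" "inv \<phi> (\<phi> j) = j" for j
    using assms by (simp_all add: bij_is_surj surj_f_inv_f bij_is_inj)
  show thesis
  proof (rule that[of "max k K0"])
    show "k \<le> \<phi> n" if "max k K0 \<le> n" for n
      using *[of "\<phi> n"] inv that by fastforce
    show "{..<k} \<subseteq> \<phi> ` {..<m}" if "max k K0 \<le> m" for m
    proof
      fix j
      assume "j \<in> {..<k}"
      then have "inv \<phi> j \<in> {..<m}" using *[of j] that by auto
      then show "j \<in> \<phi> ` {..<m}" by (metis inv(1) imageI)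
    qed
  qed simp
qed

text \<open>A stretch of the rearranged series is a sum of \<open>b\<close> over the image of that
  stretch, a finite set that avoids \<open>{..<k}\<close> once the stretch starts late
  enough.\<close>

lemma unordered_Cauchy_rearrange_Cauchy:
  fixes b :: "nat \<Rightarrow> 'a::topological_ab_group_add"
  assumes b: "unordered_Cauchy b" and "bij \<phi>"
  shows "Cauchy_summable (b \<circ> \<phi>)"
  unfolding Cauchy_summable_def group_Cauchy_def
proof (intro allI impI)
  fix U :: "'a set"
  assume "\<forall>\<^sub>F u in nhds 0. u \<in> U"
  then obtain V where V: "\<forall>\<^sub>F v in nhds 0. v \<in> V"
    "\<And>v w. v \<in> V \<Longrightarrow> w \<in> V \<Longrightarrow> v - w \<in> U"
    by (rule nhds_zero_diff) blast
  obtain k where k: "\<And>F. finite F \<Longrightarrow> F \<subseteq> {k..} \<Longrightarrow> sum b F \<in> V"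
    using b V(1) unfolding unordered_Cauchy_def by meson
  obtain K where K: "\<And>n. n \<ge> K \<Longrightarrow> \<phi> n \<ge> k"
    using bij_eventually_ge[OF \<open>bij \<phi>\<close>] by metis
  have tail: "sum (b \<circ> \<phi>) {l<..m} \<in> V" if "l \<ge> K" for l m
  proof -
    have "sum (b \<circ> \<phi>) {l<..m} = sum b (\<phi> ` {l<..m})"
      using \<open>bij \<phi>\<close> by (metis bij_is_inj inj_on_subset subset_UNIV sum.reindex)
    also have "\<dots> \<in> V"
      using K that by (intro k) auto
    finally show ?thesis .
  qed
  \<comment> \<open>Writing a tail \<open>t\<close> as \<open>t - 0\<close> and its negative as
    \<open>0 - t\<close> lets \<open>V(2)\<close> handle both orders of \<open>l\<close> and
    \<open>m\<close>.\<close>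
  have "0 \<in> V" using k[of "{}"] by simp
  have "sum (b \<circ> \<phi>) {..m} - sum (b \<circ> \<phi>) {..l} \<in> U" if "l \<ge> K" "m \<ge> K" for l m
  proof (cases "l \<le> m")
    case True
    then show ?thesis
      using V(2)[OF tail[OF \<open>l \<ge> K\<close>, of m] \<open>0 \<in> V\<close>] by (simp add: sum_atMost_diff)
  next
    case False
    then have "sum (b \<circ> \<phi>) {..m} - sum (b \<circ> \<phi>) {..l} = 0 - sum (b \<circ> \<phi>) {m<..l}"
      by (simp flip: sum_atMost_diff)
    then show ?thesis
      using V(2)[OF \<open>0 \<in> V\<close> tail[OF \<open>m \<ge> K\<close>, of l]] by simp
  qed
  then show "\<exists>k. \<forall>l\<ge>k. \<forall>m\<ge>k. (\<Sum>n\<le>m. (b \<circ> \<phi>) n) - (\<Sum>n\<le>l. (b \<circ> \<phi>) n) \<in> U"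
    by blast
qed

text \<open>The group may be incomplete, so the limit has to come from \<open>b\<close> itself: the
  partial sums of the two series differ by a null sequence, hence share their limit.\<close>

lemma unordered_Cauchy_rearrange_summable:
  fixes b :: "nat \<Rightarrow> 'a::topological_ab_group_add"
  assumes b: "unordered_Cauchy b" and "bij \<phi>" and "summable b"
  shows "summable (b \<circ> \<phi>)"
proof -
  have diff: "(\<lambda>m. sum (b \<circ> \<phi>) {..<m} - sum b {..<m}) \<longlonglongrightarrow> 0"
    unfolding tendsto_def
  proof (intro allI impI)
    fix U :: "'a set"
    assume "open U" "0 \<in> U"
    then have "\<forall>\<^sub>F u in nhds 0. u \<in> U" by (rule eventually_nhds_in_open)
    then obtain V where V: "\<forall>\<^sub>F v in nhds 0. v \<in> V"
      "\<And>v w. v \<in> V \<Longrightarrow> w \<in> V \<Longrightarrow> v - w \<in> U"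
      by (rule nhds_zero_diff) blast
    obtain k where k: "\<And>F. finite F \<Longrightarrow> F \<subseteq> {k..} \<Longrightarrow> sum b F \<in> V"
      using b V(1) unfolding unordered_Cauchy_def by meson
    obtain K where K: "k \<le> K" "\<And>m. m \<ge> K \<Longrightarrow> {..<k} \<subseteq> \<phi> ` {..<m}"
      using bij_eventually_ge[OF \<open>bij \<phi>\<close>] by metis
    have "sum (b \<circ> \<phi>) {..<m} - sum b {..<m} \<in> U" if "m \<ge> K" for m
    proof -
      define X where "X = \<phi> ` {..<m}"
      have "sum (b \<circ> \<phi>) {..<m} = sum b X"
        unfolding X_def using \<open>bij \<phi>\<close>
        by (metis bij_is_inj inj_on_subset subset_UNIV sum.reindex)
      also have "\<dots> = sum b (X \<inter> {..<m}) + sum b (X - {..<m})"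
        by (rule sum.Int_Diff) (simp add: X_def)
      \<comment> \<open>The common part \<open>X \<inter> {..<m}\<close> cancels. Both remainders
        avoid \<open>{..<k}\<close>, since \<open>{..<m}\<close> and \<open>X\<close> each contain
        it.\<close>
      finally have "sum (b \<circ> \<phi>) {..<m} - sum b {..<m} = sum b (X - {..<m}) - sum b ({..<m} - X)"
        using sum.Int_Diff[of "{..<m}" b X] by (simp add: Int_commute)
      also have "\<dots> \<in> U"
      proof (intro V(2) k)
        show "X - {..<m} \<subseteq> {k..}"
          using K(1) \<open>m \<ge> K\<close> by auto
        show "{..<m} - X \<subseteq> {k..}"
          using K(2)[OF \<open>m \<ge> K\<close>] by (auto simp: X_def simp flip: not_less)
      qed (simp_all add: X_def)
      finally show ?thesis .
    qed
    then show "\<forall>\<^sub>F m in sequentially. sum (b \<circ> \<phi>) {..<m} - sum b {..<m} \<in> U"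
      by (auto simp: eventually_sequentially)
  qed
  obtain s where "(\<lambda>m. sum b {..<m}) \<longlonglongrightarrow> s"
    using \<open>summable b\<close> by (auto simp: summable_def sums_def)
  from tendsto_add[OF diff this] show ?thesis
    by (auto simp: summable_def sums_def)
qed

section \<open>Application to bounded integer coefficients\<close>

lemma f_Cauchy_summable_imp_unordered_Cauchy:
  assumes "f_Cauchy_summable f a" and z: "\<And>n. enat (nat \<bar>z n\<bar>) \<le> f n"
  shows "unordered_Cauchy (\<lambda>n. int_mult (z n) (a n))"
proof (rule subseries_Cauchy_imp_unordered_Cauchy)
  fix A :: "nat set"
  have "enat (nat \<bar>if n \<in> A then z n else 0\<bar>) \<le> f n" for n
    using z[of n] by (simp flip: zero_enat_def)
  then have "Cauchy_summable (\<lambda>n. int_mult (if n \<in> A then z n else 0) (a n))"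
    using assms(1) by (simp add: f_Cauchy_summable_def)
  \<comment> \<open>The coefficient \<open>0\<close> yields an empty sum, so switching it off
    deletes the term.\<close>
  moreover have "int_mult (if n \<in> A then z n else 0) (a n) =
      (if n \<in> A then int_mult (z n) (a n) else 0)" for n
    by (simp add: int_mult_def)
  ultimately show "Cauchy_summable (\<lambda>n. if n \<in> A then int_mult (z n) (a n) else 0)"
    by simp
qed

lemma f_summable_imp_f_Cauchy_summable: "f_summable f a \<Longrightarrow> f_Cauchy_summable f a"
  unfolding f_summable_def f_Cauchy_summable_def
  by (blast intro: summable_imp_Cauchy_summable)

text \<open>Carrying the coefficients back along \<open>inv \<phi>\<close> exhibits every admissible
  series of the permuted sequence as a rearrangement of an admissible series of
  \<open>a\<close>.\<close>

lemma rearranged_coefficients: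
  fixes z :: "nat \<Rightarrow> int" and \<phi> :: "nat \<Rightarrow> nat"
  assumes "bij \<phi>" and "\<And>n. enat (nat \<bar>z n\<bar>) \<le> (f \<circ> \<phi>) n"
  obtains w where "\<And>n. enat (nat \<bar>w n\<bar>) \<le> f n"
    "(\<lambda>n. int_mult (z n) ((a \<circ> \<phi>) n)) = (\<lambda>n. int_mult (w n) (a n)) \<circ> \<phi>"
proof (rule that[of "z \<circ> inv \<phi>"])
  show "enat (nat \<bar>(z \<circ> inv \<phi>) n\<bar>) \<le> f n" for n
    using assms(2)[of "inv \<phi> n"] assms(1) by (simp add: bij_is_surj surj_f_inv_f)
  show "(\<lambda>n. int_mult (z n) ((a \<circ> \<phi>) n)) = (\<lambda>n. int_mult ((z \<circ> inv \<phi>) n) (a n)) \<circ> \<phi>"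
    using assms(1) by (simp add: fun_eq_iff bij_is_inj)
qed

lemma f_Cauchy_summable_rearrange:
  assumes f: "f_Cauchy_summable f a" and "bij \<phi>"
  shows "f_Cauchy_summable (f \<circ> \<phi>) (a \<circ> \<phi>)"
  unfolding f_Cauchy_summable_def
proof (intro conjI allI impI)
  show "inj (a \<circ> \<phi>)"
    using assms by (simp add: f_Cauchy_summable_def inj_compose bij_is_inj)
  fix z :: "nat \<Rightarrow> int"
  assume "\<forall>n. enat (nat \<bar>z n\<bar>) \<le> (f \<circ> \<phi>) n"
  then obtain w where w: "\<And>n. enat (nat \<bar>w n\<bar>) \<le> f n"
    "(\<lambda>n. int_mult (z n) ((a \<circ> \<phi>) n)) = (\<lambda>n. int_mult (w n) (a n)) \<circ> \<phi>"
    using rearranged_coefficients[OF \<open>bij \<phi>\<close>] by metis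
  show "Cauchy_summable (\<lambda>n. int_mult (z n) ((a \<circ> \<phi>) n))"
    unfolding w(2) using f_Cauchy_summable_imp_unordered_Cauchy[OF f w(1)] \<open>bij \<phi>\<close>
    by (rule unordered_Cauchy_rearrange_Cauchy)
qed

lemma f_summable_rearrange:
  assumes f: "f_summable f a" and "bij \<phi>"
  shows "f_summable (f \<circ> \<phi>) (a \<circ> \<phi>)"
  unfolding f_summable_def
proof (intro conjI allI impI)
  show "inj (a \<circ> \<phi>)"
    using assms by (simp add: f_summable_def inj_compose bij_is_inj)
  fix z :: "nat \<Rightarrow> int"
  assume "\<forall>n. enat (nat \<bar>z n\<bar>) \<le> (f \<circ> \<phi>) n"
  then obtain w where w: "\<And>n. enat (nat \<bar>w n\<bar>) \<le> f n"
    "(\<lambda>n. int_mult (z n) ((a \<circ> \<phi>) n)) = (\<lambda>n. int_mult (w n) (a n)) \<circ> \<phi>"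
    using rearranged_coefficients[OF \<open>bij \<phi>\<close>] by metis
  \<comment> \<open>Summability enters twice: here it supplies a limit, and through
    \<open>f_Cauchy_summable\<close> it gives control of finite sums.\<close>
  have "summable (\<lambda>n. int_mult (w n) (a n))"
    using f w(1) by (simp add: f_summable_def)
  with f_Cauchy_summable_imp_unordered_Cauchy[OF f_summable_imp_f_Cauchy_summable[OF f] w(1)]
    \<open>bij \<phi>\<close>
  show "summable (\<lambda>n. int_mult (z n) ((a \<circ> \<phi>) n))"
    unfolding w(2) by (rule unordered_Cauchy_rearrange_summable)
qed

theorem corollary4p8:
  fixes f :: "nat \<Rightarrow> enat"
    and a :: "nat \<Rightarrow> 'a::{topological_ab_group_add, t2_space}"
  assumes "f \<in> W_infty"
  shows "(f_summable f a \<longleftrightarrow> unconditionally_f_summable f a) \<and>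
         (f_Cauchy_summable f a \<longleftrightarrow> unconditionally_f_Cauchy_summable f a)"
proof (intro conjI iffI)
  assume "f_summable f a"
  then show "unconditionally_f_summable f a"
    unfolding unconditionally_f_summable_def
    by (simp add: f_summable_rearrange) (simp add: f_summable_def)
next
  assume "unconditionally_f_summable f a"
  \<comment> \<open>Specialise to the identity permutation.\<close>
  then show "f_summable f a"
    unfolding unconditionally_f_summable_def by (metis bij_id comp_id)
next
  assume "f_Cauchy_summable f a"
  then show "unconditionally_f_Cauchy_summable f a"
    unfolding unconditionally_f_Cauchy_summable_def
    by (simp add: f_Cauchy_summable_rearrange) (simp add: f_Cauchy_summable_def)
next
  assume "unconditionally_f_Cauchy_summable f a"
  then show "f_Cauchy_summable f a"
    unfolding unconditionally_f_Cauchy_summable_def by (metis bij_id comp_id)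
qed

end
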